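(* Let $p_{Y|X}$ be a discrete-time memoryless channel with finite input alphabet $\mathcal X$ and finite output alphabet $\mathcal Y$, and let $\mathcal{C}_F>0$ be its fountain capacity, which equals the Shannon capacity $\max_{p_X} I(X;Y)$. For $0<R<\mathcal C_F$ define $$E_{Fc}(R)=\max_{p_X,\ \frac{R}{\mathcal{C}_F}\le r_o \le 1,\ 0\le \rho \le 1}(1-r_o)\left( -\rho \frac{R}{r_o} + E_0(\rho, p_X)\left[1 -\frac{1+r_o}{2}E_0(\rho, p_X)\right] \right),$$ $$\tilde{E}_{Fc}(R)=\max_{p_X,\ \frac{R}{\mathcal{C}_F}\le r_o \le 1,\ 0\le \rho \le 1}(1-r_o)\left( -\rho \frac{R}{r_o} + E_0(\rho, p_X)\left[1 -E_0(\rho, p_X)\right] \right),$$ and Forney's error exponent $$E_c(R)=\max_{p_X,\ \frac{R}{\mathcal{C}_F}\le r_o \le 1,\ 0\le \rho \le 1}(1-r_o)\left( -\rho \frac{R}{r_o} + E_0(\rho, p_X) \right),$$ where $p_X$ ranges over probability distributions on $\mathcal X$ and $$E_0(\rho, p_X)=-\log\sum_{y\in\mathcal Y} \left( \sum_{x\in\mathcal X} p_X(x)\,p_{Y|X}(y|x)^{\frac{1}{1+\rho}}\right)^{1+\rho}.$$ Then $\tilde E_{Fc}(R)\le E_{Fc}(R)\le E_c(R)$ for all $0<R<\mathcal C_F$, and the bounds are asymptotically tight in the sense that $$\lim_{R\to \mathcal{C}_F} \frac{\tilde{E}_{Fc}(R)}{E_{Fc}(R)} =1.$$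
   Context: All logarithms are natural; mutual information and capacity are measured in nats. The limit $R\to\mathcal C_F$ is taken from below. *)

theory Defs
  imports "HOL-Probability.Probability"
begin

text \<open>
  A discrete memoryless channel with input alphabet \<open>'x\<close> and output alphabet \<open>'y\<close> is given by its
  transition kernel \<open>W :: 'x \<Rightarrow> 'y pmf\<close>, so that \<open>pmf (W x) y\<close> is $p_{Y|X}(y|x)$. All information
  quantities are in nats.
\<close>

text \<open>
  The value is meaningful only if the maximum is attained; it is unspecified otherwise. In all uses
  below the maximum exists for \<open>0 < R < capacity W\<close>: the objective functions are continuous in the
  parameters, which range over compact sets.
\<close>

definition max_on :: "('a \<Rightarrow> real) \<Rightarrow> 'a set \<Rightarrow> real" where
  "max_on f S = (GREATEST v. v \<in> f ` S)"

lemma max_on_eqI: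
  assumes "a \<in> S" "\<And>b. b \<in> S \<Longrightarrow> f b \<le> f a"
  shows "max_on f S = f a"
  unfolding max_on_def using assms by (intro Greatest_equality) auto

definition joint_pmf :: "('x \<Rightarrow> 'y pmf) \<Rightarrow> 'x pmf \<Rightarrow> ('x \<times> 'y) pmf" where
  "joint_pmf W p = bind_pmf p (\<lambda>x. map_pmf (Pair x) (W x))"

definition mutual_info :: "('x::finite \<Rightarrow> 'y::finite pmf) \<Rightarrow> 'x pmf \<Rightarrow> real" where
  "mutual_info W p =
     prob_space.mutual_information (measure_pmf (joint_pmf W p)) (exp 1)
       (count_space UNIV) (count_space UNIV) fst snd"

lemma mutual_info_eq:
  "mutual_info W p =
     (\<Sum>(x, y)\<in>UNIV. pmf p x * pmf (W x) y *
        ln (pmf p x * pmf (W x) y / (pmf p x * (\<Sum>x'\<in>UNIV. pmf p x' * pmf (W x') y))))"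
proof -
  let ?J = "joint_pmf W p"
  interpret information_space "measure_pmf ?J" "exp 1"
    by unfold_locales auto
  have j: "pmf ?J (x,y) = pmf p x * pmf (W x) y" for x y
  proof -
    have "pmf ?J (x,y) = (\<Sum>x'\<in>UNIV. pmf p x' * (if x' = x then pmf (W x) y else 0))"
      unfolding joint_pmf_def pmf_bind
      by (subst integral_measure_pmf[where A=UNIV])
         (auto intro!: sum.cong simp: pmf_map vimage_def pmf.rep_eq)
    also have "\<dots> = pmf p x * pmf (W x) y"
      by (simp add: if_distrib cong: if_cong)
    finally show ?thesis .
  qed
  have Jxy: "simple_distributed ?J (\<lambda>x. (fst x, snd x)) (\<lambda>(x,y). pmf p x * pmf (W x) y)"
    by (rule measure_pmf.simple_distributedI) (auto simp: simple_function_def vimage_def j measure_pmf_single)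
  have fst': "measure ?J {z. fst z = x} = (\<Sum>y\<in>UNIV. pmf p x * pmf (W x) y)" for x
  proof -
    have "{z. fst z = x} = Pair x ` (UNIV::'b set)" by auto
    thus ?thesis by (simp add: measure_measure_pmf_finite sum.reindex inj_on_def j)
  qed
  have snd': "measure ?J {z. snd z = y} = (\<Sum>x\<in>UNIV. pmf p x * pmf (W x) y)" for y
  proof -
    have "{z. snd z = y} = (\<lambda>x. (x,y)) ` (UNIV::'a set)" by auto
    thus ?thesis by (simp add: measure_measure_pmf_finite sum.reindex inj_on_def j)
  qed
  have s1: "(\<Sum>y\<in>UNIV. pmf p x * pmf (W x) y) = pmf p x" for x
    by (simp add: sum_distrib_left[symmetric] sum_pmf_eq_1)
  have Jx: "simple_distributed ?J fst (pmf p)"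
    by (rule measure_pmf.simple_distributedI) (auto simp: simple_function_def vimage_def fst' s1)
  have Jy: "simple_distributed ?J snd (\<lambda>y. \<Sum>x\<in>UNIV. pmf p x * pmf (W x) y)"
    by (rule measure_pmf.simple_distributedI) (auto simp: simple_function_def vimage_def snd' intro!: sum_nonneg)
  have r: "range (fst::'a\<times>'b\<Rightarrow>'a) = UNIV" "range (snd::'a\<times>'b\<Rightarrow>'b) = UNIV" "range (\<lambda>x. (fst x, snd x) :: 'a \<times> 'b) = UNIV" 
    by (auto simp: image_iff)
  show ?thesis
    using mutual_information_simple_distributed[OF Jx Jy Jxy]
    by (simp add: mutual_info_def r log_def case_prod_unfold)
qed

text \<open>The Shannon capacity, with which the fountain capacity of the channel coincides.\<close>

definition capacity :: "('x::finite \<Rightarrow> 'y::finite pmf) \<Rightarrow> real" where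
  "capacity W = max_on (mutual_info W) UNIV"

definition E0 :: "('x::finite \<Rightarrow> 'y::finite pmf) \<Rightarrow> real \<Rightarrow> 'x pmf \<Rightarrow> real" where
  "E0 W \<rho> p =
     - ln (\<Sum>y\<in>UNIV. (\<Sum>x\<in>UNIV. pmf p x * pmf (W x) y powr (1 / (1 + \<rho>))) powr (1 + \<rho>))"

definition param_set ::
  "('x::finite \<Rightarrow> 'y::finite pmf) \<Rightarrow> real \<Rightarrow> ('x pmf \<times> real \<times> real) set" where
  "param_set W R = UNIV \<times> {R / capacity W..1} \<times> {0..1}"

definition E_Fc :: "('x::finite \<Rightarrow> 'y::finite pmf) \<Rightarrow> real \<Rightarrow> real" where
  "E_Fc W R = max_on
     (\<lambda>(p, r, \<rho>). (1 - r) * (- \<rho> * (R / r) + E0 W \<rho> p * (1 - (1 + r) / 2 * E0 W \<rho> p)))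
     (param_set W R)"

definition E_Fc_tilde :: "('x::finite \<Rightarrow> 'y::finite pmf) \<Rightarrow> real \<Rightarrow> real" where
  "E_Fc_tilde W R = max_on
     (\<lambda>(p, r, \<rho>). (1 - r) * (- \<rho> * (R / r) + E0 W \<rho> p * (1 - E0 W \<rho> p)))
     (param_set W R)"

text \<open>Forney's error exponent for concatenated codes.\<close>

definition E_c :: "('x::finite \<Rightarrow> 'y::finite pmf) \<Rightarrow> real \<Rightarrow> real" where
  "E_c W R = max_on
     (\<lambda>(p, r, \<rho>). (1 - r) * (- \<rho> * (R / r) + E0 W \<rho> p))
     (param_set W R)"

end

theory Submission imports Defs "HOL-Real_Asymp.Real_Asymp"
begin

text \<open>
  All maxima are attained because distributions on a finite alphabet form a compact simplex. Write
  \<open>C\<close> for the capacity and \<open>d = C - R\<close>. Jensen's inequality gives \<open>0 \<le> E0 \<rho> p \<le> \<rho> I(p) \<le> \<rho> C\<close>, and for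
  a capacity-achieving \<open>p\<close> a second-order expansion gives \<open>E0 \<rho> p \<ge> \<rho> C - K \<rho>\<^sup>2\<close>. Taking \<open>r\<close> halfway
  between \<open>R / C\<close> and 1 and \<open>\<rho>\<close> a small multiple of \<open>d\<close>, the smaller exponent is at least of order
  \<open>d\<^sup>3\<close>. Conversely, positivity of the larger objective at its maximizer forces \<open>\<rho> = O(d)\<close>, hence
  \<open>E0 = O(d)\<close>; since also \<open>1 - r \<le> d / C\<close>, the two objectives there differ by
  \<open>(1 - r)\<^sup>2 E0\<^sup>2 / 2\<close>, which is only of order \<open>d ^ 4\<close>.
\<close>

section \<open>Compactness of the probability simplex and attainment of the capacity\<close>

lemma range_pmf_vec:
  "range (\<lambda>p :: 'x::finite pmf. \<chi> x. pmf p x) = cbox 0 1 \<inter> {v :: real ^ 'x. (\<Sum>x\<in>UNIV. v $ x) = 1}"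
proof (intro equalityI subsetI)
  fix v assume "v \<in> range (\<lambda>p :: 'x pmf. \<chi> x. pmf p x)"
  then show "v \<in> cbox 0 1 \<inter> {v. (\<Sum>x\<in>UNIV. v $ x) = 1}"
    by (auto simp: mem_box_cart pmf_le_1 sum_pmf_eq_1)
next
  fix v :: "real ^ 'x" assume v: "v \<in> cbox 0 1 \<inter> {v. (\<Sum>x\<in>UNIV. v $ x) = 1}"
  then have nonneg: "v $ x \<ge> 0" for x
    by (simp add: mem_box_cart)
  have "(\<integral>\<^sup>+ x. ennreal (v $ x) \<partial>count_space UNIV) = 1"
    using v nonneg by (simp add: nn_integral_count_space_finite sum_ennreal)
  then have "pmf (embed_pmf (($) v)) x = v $ x" for x
    using nonneg by (intro pmf_embed_pmf) auto
  then have "v = (\<chi> x. pmf (embed_pmf (($) v)) x)"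
    by (simp add: vec_eq_iff)
  then show "v \<in> range (\<lambda>p. \<chi> x. pmf p x)"
    by blast
qed

text \<open>In Euclidean coordinates the distributions are a closed slice of the unit box.
  Maximization over \<open>'x pmf\<close> is carried out on this image.\<close>

lemma compact_range_pmf_vec: "compact (range (\<lambda>p :: 'x::finite pmf. \<chi> x. pmf p x))"
proof -
  have "closed {v :: real ^ 'x. (\<Sum>x\<in>UNIV. v $ x) = 1}"
    by (intro closed_Collect_eq continuous_intros)
  then show ?thesis
    unfolding range_pmf_vec by (intro compact_Int_closed compact_cbox)
qed

text \<open>The product is 0 at 0, which agrees with the one-sided limit. Continuity at this
  endpoint matters because probabilities may vanish.\<close>

lemma continuous_on_x_ln_x: "continuous_on {0..} (\<lambda>x::real. x * ln x)"
proof -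
  have "((\<lambda>x::real. x * ln x) \<longlongrightarrow> 0) (at_right 0)"
    by real_asymp
  then have "((\<lambda>x::real. x * ln x) \<longlongrightarrow> 0) (at 0 within {0..})"
    by (simp add: at_within_Ici_at_right)
  moreover have "continuous (at x within {0..}) (\<lambda>x::real. x * ln x)" if "x > 0" for x
    using that by (intro continuous_intros) auto
  ultimately show ?thesis
    unfolding continuous_on_eq_continuous_within
    by (auto simp: continuous_within le_less)
qed

lemma mutual_info_eq_sum:
  "mutual_info W p =
     (\<Sum>y\<in>UNIV. \<Sum>x\<in>UNIV. pmf p x * pmf (W x) y *
        ln (pmf (W x) y / (\<Sum>x'\<in>UNIV. pmf p x' * pmf (W x') y)))"
proof -
  have "mutual_info W p = (\<Sum>(x, y)\<in>UNIV. pmf p x * pmf (W x) y *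
        ln (pmf (W x) y / (\<Sum>x'\<in>UNIV. pmf p x' * pmf (W x') y)))"
    \<comment> \<open>The factor \<open>pmf p x\<close> cancels inside the logarithm; where it is 0,
      the weight in front removes the term.\<close>
    unfolding mutual_info_eq by (intro sum.cong) auto
  also have "\<dots> = (\<Sum>x\<in>UNIV. \<Sum>y\<in>UNIV. pmf p x * pmf (W x) y *
        ln (pmf (W x) y / (\<Sum>x'\<in>UNIV. pmf p x' * pmf (W x') y)))"
    by (simp add: sum.cartesian_product)
  finally show ?thesis
    by (subst sum.swap)
qed

text \<open>Splitting the logarithm leaves \<open>p\<close> only in linear terms and in terms of the
  shape \<open>t * ln t\<close>, so the expression is continuous up to the boundary of the simplex.
  Where the joint probability is positive, so is the output probability; elsewhere both sides
  vanish.\<close>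

lemma mutual_info_eq_entropy_diff:
  "mutual_info W p =
     (\<Sum>y\<in>UNIV. (\<Sum>x\<in>UNIV. pmf p x * (pmf (W x) y * ln (pmf (W x) y))) -
        (\<Sum>x\<in>UNIV. pmf p x * pmf (W x) y) * ln (\<Sum>x\<in>UNIV. pmf p x * pmf (W x) y))"
proof -
  have "pmf p x * pmf (W x) y * ln (pmf (W x) y / (\<Sum>x'\<in>UNIV. pmf p x' * pmf (W x') y))
     = pmf p x * (pmf (W x) y * ln (pmf (W x) y)) -
       pmf p x * pmf (W x) y * ln (\<Sum>x'\<in>UNIV. pmf p x' * pmf (W x') y)" for x y
  proof (cases "pmf p x * pmf (W x) y = 0")
    case False
    then have "pmf p x * pmf (W x) y > 0"
      by (simp add: less_le)
    also have "\<dots> \<le> (\<Sum>x'\<in>UNIV. pmf p x' * pmf (W x') y)"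
      by (rule member_le_sum) auto
    finally show ?thesis
      using False by (simp add: ln_div less_le right_diff_distrib)
  qed auto
  then show ?thesis
    by (simp add: mutual_info_eq_sum sum_subtractf sum_distrib_right)
qed

text \<open>Since \<open>max_on\<close> is a \<open>GREATEST\<close>, the capacity can be used only
  once a maximizer is known. It comes from compactness, applied to the extension \<open>?g\<close>
  of the mutual information to vectors.\<close>

lemma capacity_attained:
  obtains p where "capacity W = mutual_info W p" "\<And>p'. mutual_info W p' \<le> capacity W"
proof -
  let ?g = "\<lambda>v :: real ^ 'a.
     \<Sum>y\<in>UNIV. (\<Sum>x\<in>UNIV. v $ x * (pmf (W x) y * ln (pmf (W x) y))) -
        (\<Sum>x\<in>UNIV. v $ x * pmf (W x) y) * ln (\<Sum>x\<in>UNIV. v $ x * pmf (W x) y)"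
  have "continuous_on (range (\<lambda>p. \<chi> x. pmf p x)) ?g"
    by (intro continuous_intros continuous_on_compose2[OF continuous_on_x_ln_x])
       (auto intro!: sum_nonneg)
  from continuous_attains_sup[OF compact_range_pmf_vec _ this]
  obtain p where "\<And>p'. mutual_info W p' \<le> mutual_info W p"
    by (auto simp: mutual_info_eq_entropy_diff)
  moreover from this have "capacity W = mutual_info W p"
    unfolding capacity_def by (intro max_on_eqI) auto
  ultimately show ?thesis
    using that by metis
qed

section \<open>Gallager's function expressed through posteriors and information densities\<close>

definition output_prob :: "('x::finite \<Rightarrow> 'y pmf) \<Rightarrow> 'x pmf \<Rightarrow> 'y \<Rightarrow> real" where
  "output_prob W p y = (\<Sum>x\<in>UNIV. pmf p x * pmf (W x) y)"

definition info_density :: "('x::finite \<Rightarrow> 'y pmf) \<Rightarrow> 'x pmf \<Rightarrow> 'x \<Rightarrow> 'y \<Rightarrow> real" where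
  "info_density W p x y = ln (pmf (W x) y / output_prob W p y)"

text \<open>The Bayes posterior of the input given the output. At an output of probability 0,
  division by zero makes it vanish identically, so it is a distribution only off that case. It also
  vanishes where \<open>pmf (W x) y = 0\<close>, which hides the arbitrary value of
  \<open>info_density\<close> there.\<close>

definition posterior :: "('x::finite \<Rightarrow> 'y pmf) \<Rightarrow> 'x pmf \<Rightarrow> 'y \<Rightarrow> 'x \<Rightarrow> real" where
  "posterior W p y x = pmf p x * pmf (W x) y / output_prob W p y"

lemma output_prob_nonneg: "output_prob W p y \<ge> 0"
  by (simp add: output_prob_def sum_nonneg)

lemma posterior_nonneg: "posterior W p y x \<ge> 0"
  by (simp add: posterior_def output_prob_nonneg)

lemma sum_output_prob: "(\<Sum>y\<in>UNIV. output_prob W p (y :: 'y::finite)) = 1"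
  unfolding output_prob_def
  by (subst sum.swap) (simp add: sum_pmf_eq_1 flip: sum_distrib_left)

lemma sum_posterior: "output_prob W p y \<noteq> 0 \<Longrightarrow> (\<Sum>x\<in>UNIV. posterior W p y x) = 1"
  by (simp add: posterior_def output_prob_def flip: sum_divide_distrib)

lemma pmf_mult_eq_0_if_output_prob_eq_0:
  "output_prob W p y = 0 \<Longrightarrow> pmf p x * pmf (W x) y = 0"
  by (simp add: output_prob_def sum_nonneg_eq_0_iff del: mult_eq_0_iff)

text \<open>This nested mean mirrors the two sums in Gallager's function, so inequalities can be
  applied first under the posterior and then under the output distribution.\<close>

lemma mutual_info_eq_posterior_mean:
  "mutual_info W p =
     (\<Sum>y\<in>UNIV. output_prob W p y * (\<Sum>x\<in>UNIV. posterior W p y x * info_density W p x y))"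
proof -
  have "output_prob W p y * (posterior W p y x * info_density W p x y) =
      pmf p x * pmf (W x) y * ln (pmf (W x) y / output_prob W p y)" for x y
    using pmf_mult_eq_0_if_output_prob_eq_0[of W p y x]
    by (cases "output_prob W p y = 0") (auto simp: posterior_def info_density_def)
  then show ?thesis
    by (simp add: mutual_info_eq_sum sum_distrib_left flip: output_prob_def)
qed

definition Gallager_summand ::
  "('x::finite \<Rightarrow> 'y pmf) \<Rightarrow> real \<Rightarrow> 'x pmf \<Rightarrow> 'y \<Rightarrow> real" where
  "Gallager_summand W \<rho> p y =
     (\<Sum>x\<in>UNIV. pmf p x * pmf (W x) y powr (1 / (1 + \<rho>))) powr (1 + \<rho>)"

lemma E0_eq_Gallager_summand: "E0 W \<rho> p = - ln (\<Sum>y\<in>UNIV. Gallager_summand W \<rho> p y)"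
  by (simp add: E0_def Gallager_summand_def)

lemma Gallager_summand_eq_0:
  assumes "output_prob W p y = 0"
  shows "Gallager_summand W \<rho> p y = 0"
proof -
  have "pmf p x * pmf (W x) y powr (1 / (1 + \<rho>)) = 0" for x
    using pmf_mult_eq_0_if_output_prob_eq_0[OF assms, of x] by auto
  then show ?thesis
    by (simp only: Gallager_summand_def) simp
qed

text \<open>
  Factoring out the output probability reduces both bounds on \<open>E0\<close> to estimates of an exponential
  moment of the information density.
\<close>

lemma Gallager_summand_eq:
  assumes "\<rho> \<ge> 0"
  shows "Gallager_summand W \<rho> p y = output_prob W p y *
    (\<Sum>x\<in>UNIV. posterior W p y x * exp (- (\<rho> / (1 + \<rho>)) * info_density W p x y)) powr (1 + \<rho>)"
proof (cases "output_prob W p y = 0")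
  case True
  then show ?thesis by (simp add: Gallager_summand_eq_0)
next
  case False
  define q where "q = output_prob W p y"
  have q: "q > 0"
    using False output_prob_nonneg[of W p y] by (simp add: q_def)
  have "pmf p x * pmf (W x) y powr (1 / (1 + \<rho>)) =
    q powr (1 / (1 + \<rho>)) * (posterior W p y x * exp (- (\<rho> / (1 + \<rho>)) * info_density W p x y))"
    for x
  proof (cases "pmf (W x) y = 0")
    case False
    then have w: "pmf (W x) y > 0"
      by (simp add: less_le)
    \<comment> \<open>Since 1 / (1 + \<rho>) = 1 - \<rho> / (1 + \<rho>), one full factor of the
      likelihood ratio splits off to form the posterior; the rest is the exponential of the
      information density.\<close>
    have "pmf (W x) y powr (1 / (1 + \<rho>)) / q powr (1 / (1 + \<rho>)) =
        (pmf (W x) y / q) powr (1 + - (\<rho> / (1 + \<rho>)))"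
      using assms by (simp add: powr_divide field_simps)
    also have "\<dots> = pmf (W x) y / q * exp (- (\<rho> / (1 + \<rho>)) * ln (pmf (W x) y / q))"
      using w q by (subst powr_add) (simp add: powr_def)
    finally have "pmf (W x) y powr (1 / (1 + \<rho>)) / q powr (1 / (1 + \<rho>)) =
        pmf (W x) y / q * exp (- (\<rho> / (1 + \<rho>)) * ln (pmf (W x) y / q))" .
    then have "pmf (W x) y powr (1 / (1 + \<rho>)) = q powr (1 / (1 + \<rho>)) *
        (pmf (W x) y / q * exp (- (\<rho> / (1 + \<rho>)) * ln (pmf (W x) y / q)))"
      using q by (simp add: field_simps)
    then show ?thesis
      by (simp add: posterior_def info_density_def flip: q_def)
  qed (simp add: posterior_def)
  then have "(\<Sum>x\<in>UNIV. pmf p x * pmf (W x) y powr (1 / (1 + \<rho>))) = q powr (1 / (1 + \<rho>)) *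
    (\<Sum>x\<in>UNIV. posterior W p y x * exp (- (\<rho> / (1 + \<rho>)) * info_density W p x y))"
    by (simp only: sum_distrib_left)
  then show ?thesis
    using assms q
    by (simp add: Gallager_summand_def powr_mult sum_nonneg powr_powr posterior_nonneg flip: q_def)
qed

section \<open>Two-sided bounds on \<open>E0\<close>\<close>

lemma exp_le_quadratic:
  fixes z :: real
  assumes "\<bar>z\<bar> \<le> B"
  shows "exp z \<le> 1 + z + exp B * z\<^sup>2"
proof -
  obtain t where t: "\<bar>t\<bar> \<le> \<bar>z\<bar>" "exp z = (\<Sum>m<2. z ^ m / fact m) + exp t / fact 2 * z ^ 2"
    using Maclaurin_exp_le by blast
  \<comment> \<open>The Lagrange remainder is evaluated at a point no larger than \<open>B\<close>
    in modulus; its factor 1/2 is given away.\<close>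
  have "exp t \<le> exp B"
    using t(1) assms by simp
  then have "exp t / 2 \<le> exp B"
    using exp_gt_zero[of t] by linarith
  then have "exp t / 2 * z\<^sup>2 \<le> exp B * z\<^sup>2"
    by (intro mult_right_mono) auto
  with t(2) show ?thesis
    by (simp add: numeral_2_eq_2)
qed

lemma exp_Jensen:
  fixes a f :: "'a::finite \<Rightarrow> real"
  assumes "\<And>x. a x \<ge> 0" "(\<Sum>x\<in>UNIV. a x) = 1"
  shows "exp (\<Sum>x\<in>UNIV. a x * f x) \<le> (\<Sum>x\<in>UNIV. a x * exp (f x))"
  using convex_on_sum[of UNIV UNIV exp a f] exp_convex assms by simp

text \<open>Jensen's inequality for \<open>exp\<close> is used twice: under the posterior at each
  output, where the outer power turns the rate \<open>u\<close> into \<rho>, and then under the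
  output distribution.\<close>

lemma sum_Gallager_summand_ge:
  fixes W :: "'x::finite \<Rightarrow> 'y::finite pmf"
  assumes "\<rho> \<ge> 0"
  shows "exp (- \<rho> * mutual_info W p) \<le> (\<Sum>y\<in>UNIV. Gallager_summand W \<rho> p y)"
proof -
  define T where "T y = (\<Sum>x\<in>UNIV. posterior W p y x * info_density W p x y)" for y
  define u where "u = \<rho> / (1 + \<rho>)"
  have u: "u * (1 + \<rho>) = \<rho>"
    using assms by (simp add: u_def)
  have "output_prob W p y * exp (- \<rho> * T y) \<le> Gallager_summand W \<rho> p y" for y
  proof (cases "output_prob W p y = 0")
    case False
    have "exp (- u * T y) \<le> (\<Sum>x\<in>UNIV. posterior W p y x * exp (- u * info_density W p x y))"
      using exp_Jensen[of "posterior W p y" "\<lambda>x. - u * info_density W p x y"] False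
      by (simp add: posterior_nonneg sum_posterior T_def sum_distrib_left algebra_simps flip: sum_negf)
    then have "exp (- u * T y) powr (1 + \<rho>) \<le>
        (\<Sum>x\<in>UNIV. posterior W p y x * exp (- u * info_density W p x y)) powr (1 + \<rho>)"
      using assms by (intro powr_mono2) auto
    moreover have "exp (- u * T y) powr (1 + \<rho>) = exp (- (u * (1 + \<rho>)) * T y)"
      by (simp add: powr_def algebra_simps)
    ultimately have "exp (- \<rho> * T y) \<le>
        (\<Sum>x\<in>UNIV. posterior W p y x * exp (- u * info_density W p x y)) powr (1 + \<rho>)"
      by (simp only: u)
    then show ?thesis
      by (simp add: Gallager_summand_eq[OF assms] mult_left_mono output_prob_nonneg flip: u_def)
  qed (simp add: Gallager_summand_eq_0)
  then have "(\<Sum>y\<in>UNIV. output_prob W p y * exp (- \<rho> * T y)) \<le> (\<Sum>y\<in>UNIV. Gallager_summand W \<rho> p y)"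
    by (intro sum_mono)
  moreover have "exp (- \<rho> * mutual_info W p) \<le> (\<Sum>y\<in>UNIV. output_prob W p y * exp (- \<rho> * T y))"
    using exp_Jensen[of "output_prob W p" "\<lambda>y. - \<rho> * T y"]
    by (simp add: output_prob_nonneg sum_output_prob mutual_info_eq_posterior_mean
        sum_distrib_left algebra_simps T_def flip: sum_negf)
  ultimately show ?thesis
    by linarith
qed

lemma sum_Gallager_summand_pos:
  fixes W :: "'x::finite \<Rightarrow> 'y::finite pmf"
  shows "\<rho> \<ge> 0 \<Longrightarrow> (\<Sum>y\<in>UNIV. Gallager_summand W \<rho> p y) > 0"
  using sum_Gallager_summand_ge[of \<rho> W p] exp_gt_zero less_le_trans by blast

lemma E0_le_mutual_info:
  assumes "\<rho> \<ge> 0"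
  shows "E0 W \<rho> p \<le> \<rho> * mutual_info W p"
proof -
  have "- \<rho> * mutual_info W p \<le> ln (\<Sum>y\<in>UNIV. Gallager_summand W \<rho> p y)"
    using sum_Gallager_summand_ge[OF assms, of W p] sum_Gallager_summand_pos[OF assms, of W p]
    by (simp add: ln_ge_iff)
  then show ?thesis
    by (simp add: E0_eq_Gallager_summand)
qed

text \<open>Finite alphabets bound the information density by \<open>B\<close>, so second-order
  expansions have uniform errors. One expansion treats the posterior moment, another the result of
  raising it to the power 1 + \<rho>. The constant \<open>K\<close> depends on \<open>W\<close> and
  \<open>p\<close> but not on \<rho>.\<close>

lemma E0_ge_quadratic:
  fixes W :: "'x::finite \<Rightarrow> 'y::finite pmf"
  obtains K where "K \<ge> 0"
    "\<And>\<rho>. 0 \<le> \<rho> \<Longrightarrow> \<rho> \<le> 1 \<Longrightarrow> \<rho> * mutual_info W p - K * \<rho>\<^sup>2 \<le> E0 W \<rho> p"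
proof -
  define B where "B = (\<Sum>(x, y)\<in>UNIV. \<bar>info_density W p x y\<bar>)"
  have B: "\<bar>info_density W p x y\<bar> \<le> B" for x y
    unfolding B_def
    using member_le_sum[of "(x, y)" UNIV "\<lambda>(x, y). \<bar>info_density W p x y\<bar>"] by auto
  then have "B \<ge> 0"
    using abs_ge_zero order_trans by blast
  \<comment> \<open>\<open>M\<close> is the error constant of the inner expansion. \<open>K\<close>
    adds to it the error of expanding an exponential whose argument is at most (B + M) * \<rho> in
    modulus.\<close>
  define M where "M = exp B * B\<^sup>2"
  define K where "K = exp (B + M) * (B + M)\<^sup>2 + M"
  have "M \<ge> 0"
    by (simp add: M_def)
  have "\<rho> * mutual_info W p - K * \<rho>\<^sup>2 \<le> E0 W \<rho> p" if \<rho>: "0 \<le> \<rho>" "\<rho> \<le> 1" for \<rho>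
  proof -
    define u where "u = \<rho> / (1 + \<rho>)"
    have u: "0 \<le> u" "u \<le> \<rho>" "u \<le> 1" "(1 + \<rho>) * u = \<rho>"
      using \<rho> by (auto simp: u_def divide_simps algebra_simps)
    define T where "T y = (\<Sum>x\<in>UNIV. posterior W p y x * info_density W p x y)" for y
    have le: "Gallager_summand W \<rho> p y \<le> output_prob W p y * (1 - \<rho> * T y + K * \<rho>\<^sup>2)" for y
    proof (cases "output_prob W p y = 0")
      case False
      define S where "S = (\<Sum>x\<in>UNIV. posterior W p y x * exp (- u * info_density W p x y))"
      have bound: "exp (- u * info_density W p x y) \<le> 1 - u * info_density W p x y + M * u\<^sup>2" for x
      proof -
        have "u * \<bar>info_density W p x y\<bar> \<le> 1 * B"
          using u B[of x y] by (intro mult_mono) auto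
        then have "exp (- u * info_density W p x y)
            \<le> 1 + (- u * info_density W p x y) + exp B * (- u * info_density W p x y)\<^sup>2"
          using u by (intro exp_le_quadratic) (simp add: abs_mult)
        moreover have "(info_density W p x y)\<^sup>2 \<le> B\<^sup>2"
          using B[of x y] \<open>B \<ge> 0\<close> abs_le_square_iff[of "info_density W p x y" B] by simp
        then have "exp B * u\<^sup>2 * (info_density W p x y)\<^sup>2 \<le> exp B * u\<^sup>2 * B\<^sup>2"
          by (intro mult_left_mono) auto
        then have "exp B * (- u * info_density W p x y)\<^sup>2 \<le> M * u\<^sup>2"
          by (simp add: M_def power_mult_distrib mult_ac)
        ultimately show ?thesis by simp
      qed
      have "S \<le> (\<Sum>x\<in>UNIV. posterior W p y x * (1 - u * info_density W p x y + M * u\<^sup>2))"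
        unfolding S_def by (intro sum_mono mult_left_mono bound posterior_nonneg)
      also have "\<dots> = (\<Sum>x\<in>UNIV. posterior W p y x) * (1 + M * u\<^sup>2) - u * T y"
        by (simp add: T_def sum_distrib_left sum_distrib_right flip: sum_subtractf)
           (simp add: algebra_simps)
      also have "\<dots> = 1 + (M * u\<^sup>2 - u * T y)"
        using False by (simp add: sum_posterior)
      \<comment> \<open>Passing to an exponential makes the outer power a mere factor 1 + \<rho> in
        the exponent, which combines with \<open>u\<close> to \<rho>.\<close>
      also have "\<dots> \<le> exp (M * u\<^sup>2 - u * T y)"
        by (rule exp_ge_add_one_self)
      finally have "S powr (1 + \<rho>) \<le> exp (M * u\<^sup>2 - u * T y) powr (1 + \<rho>)"
        using \<rho> by (intro powr_mono2) (auto simp: S_def posterior_nonneg intro!: sum_nonneg)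
      also have "\<dots> = exp (M * (u * ((1 + \<rho>) * u)) - ((1 + \<rho>) * u) * T y)"
        by (simp add: powr_def algebra_simps power2_eq_square)
      also have "\<dots> \<le> exp (M * \<rho>\<^sup>2 - \<rho> * T y)"
        unfolding u(4) power2_eq_square using u \<rho> \<open>M \<ge> 0\<close>
        by (simp add: mult_left_mono mult_right_mono)
      finally have S_le: "S powr (1 + \<rho>) \<le> exp (M * \<rho>\<^sup>2 - \<rho> * T y)" .
      have exp_le: "exp (M * \<rho>\<^sup>2 - \<rho> * T y) \<le>
            1 + (M * \<rho>\<^sup>2 - \<rho> * T y) + exp (B + M) * (M * \<rho>\<^sup>2 - \<rho> * T y)\<^sup>2"
        and square_le: "(M * \<rho>\<^sup>2 - \<rho> * T y)\<^sup>2 \<le> (B + M)\<^sup>2 * \<rho>\<^sup>2"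
      proof -
        have "\<bar>T y\<bar> \<le> (\<Sum>x\<in>UNIV. posterior W p y x * B)"
          unfolding T_def using B
          by (intro order_trans[OF sum_abs] sum_mono)
             (simp add: abs_mult posterior_nonneg mult_left_mono)
        then have "\<bar>T y\<bar> \<le> B"
          using False by (simp add: sum_posterior flip: sum_distrib_right)
        moreover have "\<bar>M * \<rho>\<bar> \<le> M"
          using \<rho> \<open>M \<ge> 0\<close> by (simp add: mult_left_le)
        ultimately have "\<bar>M * \<rho> - T y\<bar> \<le> B + M"
          by linarith
        then have "\<bar>M * \<rho> - T y\<bar> * \<bar>\<rho>\<bar> \<le> (B + M) * \<bar>\<rho>\<bar>"
          by (intro mult_right_mono) auto
        moreover have eq: "M * \<rho>\<^sup>2 - \<rho> * T y = (M * \<rho> - T y) * \<rho>"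
          by (simp add: algebra_simps power2_eq_square)
        ultimately have *: "\<bar>M * \<rho>\<^sup>2 - \<rho> * T y\<bar> \<le> (B + M) * \<rho>"
          using \<rho> by (simp add: abs_mult)
        then have "\<bar>M * \<rho>\<^sup>2 - \<rho> * T y\<bar>\<^sup>2 \<le> ((B + M) * \<rho>)\<^sup>2"
          by (intro power_mono) auto
        then show "(M * \<rho>\<^sup>2 - \<rho> * T y)\<^sup>2 \<le> (B + M)\<^sup>2 * \<rho>\<^sup>2"
          by (simp add: power_mult_distrib)
        have "(B + M) * \<rho> \<le> B + M"
          using \<rho> \<open>M \<ge> 0\<close> \<open>B \<ge> 0\<close> by (simp add: mult_left_le)
        with * show "exp (M * \<rho>\<^sup>2 - \<rho> * T y) \<le>
            1 + (M * \<rho>\<^sup>2 - \<rho> * T y) + exp (B + M) * (M * \<rho>\<^sup>2 - \<rho> * T y)\<^sup>2"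
          by (intro exp_le_quadratic) linarith
      qed
      have "S powr (1 + \<rho>) \<le> 1 - \<rho> * T y + M * \<rho>\<^sup>2 + exp (B + M) * (M * \<rho>\<^sup>2 - \<rho> * T y)\<^sup>2"
        using S_le exp_le by linarith
      also have "\<dots> \<le> 1 - \<rho> * T y + M * \<rho>\<^sup>2 + exp (B + M) * ((B + M)\<^sup>2 * \<rho>\<^sup>2)"
        using square_le by (simp add: mult_left_mono)
      also have "\<dots> = 1 - \<rho> * T y + K * \<rho>\<^sup>2"
        by (simp add: K_def algebra_simps)
      finally show ?thesis
        unfolding Gallager_summand_eq[OF \<rho>(1)] S_def u_def
        by (intro mult_left_mono output_prob_nonneg)
    qed (simp add: Gallager_summand_eq_0)
    have "(\<Sum>y\<in>UNIV. Gallager_summand W \<rho> p y) \<le>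
        (\<Sum>y\<in>UNIV. output_prob W p y * (1 - \<rho> * T y + K * \<rho>\<^sup>2))"
      by (intro sum_mono le)
    also have "\<dots> = (\<Sum>y\<in>UNIV. output_prob W p y) * (1 + K * \<rho>\<^sup>2) - \<rho> * (\<Sum>y\<in>UNIV. output_prob W p y * T y)"
      by (simp add: sum_distrib_left sum_distrib_right flip: sum_subtractf) (simp add: algebra_simps)
    also have "\<dots> = 1 + (K * \<rho>\<^sup>2 - \<rho> * mutual_info W p)"
      by (simp add: sum_output_prob mutual_info_eq_posterior_mean T_def)
    finally have "ln (\<Sum>y\<in>UNIV. Gallager_summand W \<rho> p y) \<le> K * \<rho>\<^sup>2 - \<rho> * mutual_info W p"
      using ln_le_minus_one[OF sum_Gallager_summand_pos[OF \<rho>(1), of W p]] by linarith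
    then show ?thesis
      by (simp add: E0_eq_Gallager_summand)
  qed
  moreover have "K \<ge> 0"
    using \<open>M \<ge> 0\<close> by (simp add: K_def)
  ultimately show ?thesis
    using that by blast
qed

text \<open>Power means increase with their exponent: under \<open>p\<close>, the left side is the
  mean of order 1 / (1 + \<rho>) of the likelihoods at \<open>y\<close>, and the right side is their
  arithmetic mean.\<close>

lemma Gallager_summand_le_output_prob:
  assumes "\<rho> \<ge> 0"
  shows "Gallager_summand W \<rho> p y \<le> output_prob W p y"
proof -
  define s where "s = 1 / (1 + \<rho>)"
  define S where "S = (\<Sum>x\<in>UNIV. pmf p x * pmf (W x) y powr s)"
  define m where "m = S powr (1 + \<rho>)"
  have s: "0 < s" "s \<le> 1" "(1 + \<rho>) * (1 - s) = \<rho>"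
    using assms by (auto simp: s_def divide_simps)
  have "S \<ge> 0"
    by (simp add: S_def sum_nonneg)
  \<comment> \<open>Young's inequality against \<open>m\<close> itself: averaging over \<open>x\<close> turns the left side back into \<open>m\<close>.\<close>
  have Young: "pmf (W x) y powr s * m powr (1 - s) \<le> s * pmf (W x) y + (1 - s) * m" for x
    using s Youngs_inequality_0[of s "1 - s" "pmf (W x) y" m]
    by (cases "pmf (W x) y = 0"; cases "m = 0") (auto simp: m_def less_le)
  have "m = S * m powr (1 - s)"
    using \<open>S \<ge> 0\<close> s by (simp add: m_def powr_powr powr_mult_base)
  also have "\<dots> = (\<Sum>x\<in>UNIV. pmf p x * (pmf (W x) y powr s * m powr (1 - s)))"
    by (simp add: S_def sum_distrib_right mult.assoc)
  also have "\<dots> \<le> (\<Sum>x\<in>UNIV. pmf p x * (s * pmf (W x) y + (1 - s) * m))"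
    by (intro sum_mono mult_left_mono Young) simp
  also have "\<dots> = s * output_prob W p y + (1 - s) * m * (\<Sum>x\<in>UNIV. pmf p x)"
    by (simp add: output_prob_def sum_distrib_left algebra_simps flip: sum.distrib)
  also have "\<dots> = s * output_prob W p y + (1 - s) * m"
    by (simp add: sum_pmf_eq_1)
  finally have "s * m \<le> s * output_prob W p y"
    by (simp add: algebra_simps)
  then have "m \<le> output_prob W p y"
    using s by simp
  then show ?thesis
    by (simp add: Gallager_summand_def m_def S_def s_def)
qed

lemma E0_nonneg:
  assumes "\<rho> \<ge> 0"
  shows "E0 W \<rho> p \<ge> 0"
proof -
  have "(\<Sum>y\<in>UNIV. Gallager_summand W \<rho> p y) \<le> (\<Sum>y\<in>UNIV. output_prob W p y)"
    by (intro sum_mono Gallager_summand_le_output_prob assms)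
  then show ?thesis
    using sum_Gallager_summand_pos[OF assms, of W p]
    by (simp add: E0_eq_Gallager_summand sum_output_prob)
qed

lemma E0_le_capacity:
  assumes "\<rho> \<ge> 0"
  shows "E0 W \<rho> p \<le> \<rho> * capacity W"
  using capacity_attained[of W] E0_le_mutual_info[OF assms, of W p] assms
  by (meson mult_left_mono order_trans)

section \<open>Attained maxima and the ordering of the exponents\<close>

text \<open>The value of \<open>E0\<close> enters as a separate argument of \<open>F\<close>, so one
  compactness argument serves all the exponents. \<open>G\<close> extends \<open>E0\<close>
  continuously to vectors in the simplex, its logarithm having a positive argument there.\<close>

lemma max_on_param_set:
  fixes W :: "'x::finite \<Rightarrow> 'y::finite pmf" and F :: "real \<Rightarrow> real \<Rightarrow> real \<Rightarrow> real"
  assumes R: "R < capacity W" "capacity W > 0"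
    and cont: "continuous_on ({R / capacity W..1} \<times> {0..1} \<times> UNIV) (\<lambda>(r, \<rho>, e). F r \<rho> e)"
  obtains p r \<rho> where "(p, r, \<rho>) \<in> param_set W R"
    "max_on (\<lambda>(p, r, \<rho>). F r \<rho> (E0 W \<rho> p)) (param_set W R) = F r \<rho> (E0 W \<rho> p)"
    "\<And>p' r' \<rho>'. (p', r', \<rho>') \<in> param_set W R \<Longrightarrow>
       F r' \<rho>' (E0 W \<rho>' p') \<le> F r \<rho> (E0 W \<rho> p)"
proof -
  define S where "S = range (\<lambda>p :: 'x pmf. \<chi> x. pmf p x) \<times> {R / capacity W..1} \<times> {0..1::real}"
  define G where "G = (\<lambda>(v :: real ^ 'x, r :: real, \<rho>).
    - ln (\<Sum>y\<in>UNIV. (\<Sum>x\<in>UNIV. v $ x * pmf (W x) y powr (1 / (1 + \<rho>))) powr (1 + \<rho>)))"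
  have G: "G (\<chi> x. pmf p x, r, \<rho>) = E0 W \<rho> p" for p r \<rho>
    by (simp add: G_def E0_def)
  have \<rho>_nonneg: "snd (snd s) \<ge> 0" if "s \<in> S" for s
    using that by (simp add: S_def mem_Times_iff)
  have v_nonneg: "fst s $ x \<ge> 0" if "s \<in> S" for s x
    using that unfolding S_def mem_Times_iff by (auto elim!: imageE)
  define inner where "inner y s = (\<Sum>x\<in>UNIV. fst s $ x * pmf (W x) y powr (1 / (1 + snd (snd s))))"
    for y and s :: "(real ^ 'x) \<times> real \<times> real"
  have inner_nonneg: "inner y s \<ge> 0" if "s \<in> S" for y s
    unfolding inner_def using v_nonneg[OF that] by (intro sum_nonneg mult_nonneg_nonneg) auto
  have "continuous_on S (\<lambda>s. 1 / (1 + snd (snd s)))"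
    by (intro continuous_intros ballI) (use \<rho>_nonneg in force)
  then have "continuous_on S (\<lambda>s. c powr (1 / (1 + snd (snd s))))" if "c \<ge> 0" for c
    using that by (intro continuous_on_powr' continuous_on_const ballI)
      (use \<rho>_nonneg in \<open>auto intro!: add_pos_nonneg\<close>)
  then have "continuous_on S (inner y)" for y
    unfolding inner_def by (intro continuous_on_sum continuous_on_mult continuous_on_component
        continuous_on_fst continuous_on_id) auto
  moreover have "continuous_on S (\<lambda>s. 1 + snd (snd s))"
    by (intro continuous_intros)
  \<comment> \<open>The base may vanish; \<open>powr\<close> stays continuous there because the
    exponent is positive.\<close>
  moreover have "\<forall>s\<in>S. inner y s \<ge> 0 \<and> (inner y s = 0 \<longrightarrow> 1 + snd (snd s) > 0)" for y
    using inner_nonneg \<rho>_nonneg by (auto intro: add_pos_nonneg)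
  ultimately have cont_powr: "continuous_on S (\<lambda>s. inner y s powr (1 + snd (snd s)))" for y
    by (rule continuous_on_powr')
  have "(\<Sum>y\<in>UNIV. inner y s powr (1 + snd (snd s))) \<noteq> 0" if "s \<in> S" for s
  proof -
    have "fst s \<in> range (\<lambda>p. \<chi> x. pmf p x)" and \<rho>: "snd (snd s) \<ge> 0"
      using that by (simp_all add: S_def mem_Times_iff)
    then obtain p where "fst s = (\<chi> x. pmf p x)"
      by (elim imageE)
    then show ?thesis
      using sum_Gallager_summand_pos[OF \<rho>, of W p] by (simp add: inner_def Gallager_summand_def)
  qed
  then have "continuous_on S G"
    unfolding G_def case_prod_unfold inner_def[symmetric]
    by (intro continuous_on_minus continuous_on_ln continuous_on_sum cont_powr) auto
  then have "continuous_on S (\<lambda>s. (fst (snd s), snd (snd s), G s))"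
    by (intro continuous_intros)
  then have "continuous_on S (\<lambda>s. (\<lambda>(r, \<rho>, e). F r \<rho> e) (fst (snd s), snd (snd s), G s))"
    by (rule continuous_on_compose2[OF cont]) (simp add: S_def mem_Times_iff image_subset_iff)
  then have "continuous_on S (\<lambda>s. F (fst (snd s)) (snd (snd s)) (G s))"
    by simp
  moreover have "compact S"
    unfolding S_def by (intro compact_Times compact_range_pmf_vec compact_Icc)
  \<comment> \<open>Nonemptiness: any distribution serves, and r = 1 is admissible since R lies
    below capacity.\<close>
  moreover have "(\<chi> x. pmf undefined x, 1, 0) \<in> S"
    using R by (simp add: S_def)
  ultimately obtain s where s: "s \<in> S" "\<And>s'. s' \<in> S \<Longrightarrow>
      F (fst (snd s')) (snd (snd s')) (G s') \<le> F (fst (snd s)) (snd (snd s)) (G s)"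
    using continuous_attains_sup[of S "\<lambda>s. F (fst (snd s)) (snd (snd s)) (G s)"] by blast
  from s(1) have "fst s \<in> range (\<lambda>p. \<chi> x. pmf p x)"
    by (simp add: S_def mem_Times_iff)
  then obtain p where p: "fst s = (\<chi> x. pmf p x)"
    by (elim imageE)
  define r \<rho> where "r = fst (snd s)" and "\<rho> = snd (snd s)"
  have s_eq: "s = (\<chi> x. pmf p x, r, \<rho>)"
    by (simp add: prod_eq_iff p r_def \<rho>_def)
  have in_set: "(p, r, \<rho>) \<in> param_set W R"
    using s(1) by (simp add: S_def s_eq param_set_def)
  have max: "F r' \<rho>' (E0 W \<rho>' p') \<le> F r \<rho> (E0 W \<rho> p)" if "(p', r', \<rho>') \<in> param_set W R" for p' r' \<rho>'
    using s(2)[of "(\<chi> x. pmf p' x, r', \<rho>')"] that by (simp add: s_eq G S_def param_set_def)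
  have "max_on (\<lambda>(p, r, \<rho>). F r \<rho> (E0 W \<rho> p)) (param_set W R) = (\<lambda>(p, r, \<rho>). F r \<rho> (E0 W \<rho> p)) (p, r, \<rho>)"
    using in_set max by (intro max_on_eqI) auto
  with in_set max show ?thesis
    using that by auto
qed

text \<open>A maximizer for \<open>F\<close> is feasible for \<open>F'\<close>. The pointwise
  comparison may be restricted to nonnegative \<open>e\<close> because \<open>E0\<close> is
  nonnegative.\<close>

lemma max_on_param_set_mono:
  fixes W :: "'x::finite \<Rightarrow> 'y::finite pmf" and F F' :: "real \<Rightarrow> real \<Rightarrow> real \<Rightarrow> real"
  assumes "R < capacity W" "capacity W > 0"
    and "continuous_on ({R / capacity W..1} \<times> {0..1} \<times> UNIV) (\<lambda>(r, \<rho>, e). F r \<rho> e)"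
    and "continuous_on ({R / capacity W..1} \<times> {0..1} \<times> UNIV) (\<lambda>(r, \<rho>, e). F' r \<rho> e)"
    and le: "\<And>r \<rho> e. R / capacity W \<le> r \<Longrightarrow> r \<le> 1 \<Longrightarrow> 0 \<le> e \<Longrightarrow> F r \<rho> e \<le> F' r \<rho> e"
  shows "max_on (\<lambda>(p, r, \<rho>). F r \<rho> (E0 W \<rho> p)) (param_set W R) \<le>
    max_on (\<lambda>(p, r, \<rho>). F' r \<rho> (E0 W \<rho> p)) (param_set W R)"
proof -
  obtain p r \<rho> where 1: "(p, r, \<rho>) \<in> param_set W R"
    "max_on (\<lambda>(p, r, \<rho>). F r \<rho> (E0 W \<rho> p)) (param_set W R) = F r \<rho> (E0 W \<rho> p)"
    by (rule max_on_param_set[OF assms(1-3)])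
  obtain p' r' \<rho>' where 2:
    "max_on (\<lambda>(p, r, \<rho>). F' r \<rho> (E0 W \<rho> p)) (param_set W R) = F' r' \<rho>' (E0 W \<rho>' p')"
    "F' r \<rho> (E0 W \<rho> p) \<le> F' r' \<rho>' (E0 W \<rho>' p')"
    by (rule max_on_param_set[OF assms(1,2,4)]) (use 1(1) in blast)
  show ?thesis
    unfolding 1(2) 2(1) using le[of r "E0 W \<rho> p" \<rho>] E0_nonneg[of \<rho> W p] 1(1) 2(2)
    by (auto simp: param_set_def)
qed

text \<open>The three objectives differ only in the coefficient of the subtracted square of
  \<open>E0\<close>, which is 1, (1 + r) / 2 and 0 in turn. Positivity of \<open>R\<close> keeps
  \<open>r\<close> away from 0, so that \<open>R / r\<close> is continuous.\<close>

lemma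
  fixes W :: "'x::finite \<Rightarrow> 'y::finite pmf"
  assumes R: "0 < R" "R < capacity W"
  shows E_Fc_tilde_le_E_Fc: "E_Fc_tilde W R \<le> E_Fc W R"
    and E_Fc_le_E_c: "E_Fc W R \<le> E_c W R"
proof -
  have r_pos: "R / capacity W > 0"
    using R by simp
  then have [simp]: "R / capacity W \<le> r \<Longrightarrow> r \<noteq> 0" for r
    by auto
  have pos: "capacity W > 0"
    using R by simp
  show "E_Fc_tilde W R \<le> E_Fc W R"
    unfolding E_Fc_tilde_def E_Fc_def
  proof (rule max_on_param_set_mono[OF R(2) pos,
      where F = "\<lambda>r \<rho> e. (1 - r) * (- \<rho> * (R / r) + e * (1 - e))"
        and F' = "\<lambda>r \<rho> e. (1 - r) * (- \<rho> * (R / r) + e * (1 - (1 + r) / 2 * e))"])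
    fix r \<rho> e :: real
    assume "r \<le> 1" "0 \<le> e"
    then show "(1 - r) * (- \<rho> * (R / r) + e * (1 - e)) \<le>
        (1 - r) * (- \<rho> * (R / r) + e * (1 - (1 + r) / 2 * e))"
      using mult_right_mono[of "(1 + r) / 2" 1 e]
      by (intro mult_left_mono add_left_mono) auto
  qed (auto simp: case_prod_unfold intro!: continuous_intros)
  show "E_Fc W R \<le> E_c W R"
    unfolding E_Fc_def E_c_def
  proof (rule max_on_param_set_mono[OF R(2) pos,
      where F = "\<lambda>r \<rho> e. (1 - r) * (- \<rho> * (R / r) + e * (1 - (1 + r) / 2 * e))"
        and F' = "\<lambda>r \<rho> e. (1 - r) * (- \<rho> * (R / r) + e)"])
    fix r \<rho> e :: real
    assume r: "R / capacity W \<le> r" "r \<le> 1" "0 \<le> e"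
    then have "r > 0"
      using r_pos by linarith
    with r have "e * (1 - (1 + r) / 2 * e) \<le> e"
      by (intro mult_left_le) auto
    then show "(1 - r) * (- \<rho> * (R / r) + e * (1 - (1 + r) / 2 * e)) \<le>
        (1 - r) * (- \<rho> * (R / r) + e)"
      using r by (intro mult_left_mono add_left_mono) auto
  qed (auto simp: case_prod_unfold intro!: continuous_intros)
qed

section \<open>Asymptotic tightness near capacity\<close>

lemma E_Fc_tilde_ge_objective:
  fixes W :: "'x::finite \<Rightarrow> 'y::finite pmf"
  assumes "0 < R" "R < capacity W" "(p, r, \<rho>) \<in> param_set W R"
  shows "(1 - r) * (- \<rho> * (R / r) + E0 W \<rho> p * (1 - E0 W \<rho> p)) \<le> E_Fc_tilde W R"
proof -
  have "R / capacity W > 0"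
    using assms by simp
  then have cont: "continuous_on ({R / capacity W..1} \<times> {0..1} \<times> UNIV)
      (\<lambda>(r, \<rho>, e). (1 - r) * (- \<rho> * (R / r) + e * (1 - e)))"
    by (auto simp: case_prod_unfold intro!: continuous_intros)
  have "capacity W > 0"
    using assms by simp
  show ?thesis
    unfolding E_Fc_tilde_def
    by (rule max_on_param_set[OF assms(2) \<open>capacity W > 0\<close> cont]) (use assms(3) in fastforce)
qed

text \<open>At a capacity-achieving input the bracket is at least \<rho> * d / 2 - M * \<rho>^2. Its
  maximum d^2 / (16 * M), times 1 - r = d / (2 * C), gives the stated bound.\<close>

lemma E_Fc_tilde_cubic_lower_bound:
  fixes W :: "'x::finite \<Rightarrow> 'y::finite pmf"
  assumes C: "capacity W > 0"
  obtains M where "M > 0"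
    "\<And>R. 0 < R \<Longrightarrow> R < capacity W \<Longrightarrow> capacity W - R \<le> 4 * M \<Longrightarrow>
       (capacity W - R) ^ 3 / (32 * capacity W * M) \<le> E_Fc_tilde W R"
proof -
  define C where "C = capacity W"
  obtain p where p: "capacity W = mutual_info W p"
    by (rule capacity_attained)
  obtain K where K: "K \<ge> 0" "\<And>\<rho>. 0 \<le> \<rho> \<Longrightarrow> \<rho> \<le> 1 \<Longrightarrow> \<rho> * C - K * \<rho>\<^sup>2 \<le> E0 W \<rho> p"
    by (rule E0_ge_quadratic[of W p]) (simp add: C_def p)
  \<comment> \<open>\<open>K\<close> accounts for the quadratic loss in \<open>E0\<close>, and the
    square of C for the subtracted square of \<open>E0\<close>, which is at most that of \<rho> *
    C.\<close>
  define M where "M = K + C\<^sup>2"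
  have M: "M > 0"
    using K C by (simp add: M_def C_def add_nonneg_pos)
  have "(C - R) ^ 3 / (32 * C * M) \<le> E_Fc_tilde W R" if R: "0 < R" "R < C" "C - R \<le> 4 * M" for R
  proof -
    define d where "d = C - R"
    define r where "r = (C + R) / (2 * C)"
    \<comment> \<open>The maximizer of \<rho> * d / 2 - M * \<rho>^2; the condition d \<le> 4 * M
      makes it admissible.\<close>
    define \<rho> where "\<rho> = d / (4 * M)"
    have \<rho>: "0 < \<rho>" "\<rho> \<le> 1"
      using R M by (auto simp: \<rho>_def d_def)
    have in_set: "(p, r, \<rho>) \<in> param_set W R"
      using \<rho> R by (auto simp: param_set_def r_def field_simps simp flip: C_def)
    have r: "1 - r = d / (2 * C)"
      using R by (simp add: r_def d_def field_simps)
    \<comment> \<open>Holds because C + R is at most 2 * C.\<close>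
    have "d / 2 \<le> C * d / (C + R)"
      using R zero_le_square[of "C - R"] by (simp add: d_def field_simps)
    also have "\<dots> = C - R / r"
      using R by (simp add: r_def d_def field_simps)
    finally have "\<rho> * (d / 2) \<le> \<rho> * (C - R / r)"
      using \<rho> by (intro mult_left_mono) auto
    moreover have "(E0 W \<rho> p)\<^sup>2 \<le> (\<rho> * C)\<^sup>2"
      using E0_le_capacity[of \<rho> W p] E0_nonneg[of \<rho> W p] \<rho> by (intro power_mono) (auto simp: C_def)
    ultimately have "\<rho> * (d / 2) - M * \<rho>\<^sup>2 \<le> - \<rho> * (R / r) + E0 W \<rho> p * (1 - E0 W \<rho> p)"
      using K(2)[of \<rho>] \<rho> by (simp add: M_def algebra_simps power2_eq_square)
    moreover have "\<rho> * (d / 2) - M * \<rho>\<^sup>2 = d\<^sup>2 / (16 * M)"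
      using M by (simp add: \<rho>_def field_simps power2_eq_square)
    ultimately have "d / (2 * C) * (d\<^sup>2 / (16 * M)) \<le>
        (1 - r) * (- \<rho> * (R / r) + E0 W \<rho> p * (1 - E0 W \<rho> p))"
      unfolding r using R by (intro mult_left_mono) (auto simp: d_def)
    also have "\<dots> \<le> E_Fc_tilde W R"
      using R in_set by (intro E_Fc_tilde_ge_objective) (auto simp: C_def)
    finally show ?thesis
      by (simp add: power2_eq_square power3_eq_cube flip: d_def)
  qed
  with M show ?thesis
    using that unfolding C_def by blast
qed

text \<open>A maximizer for \<open>E_Fc\<close> is feasible for \<open>E_Fc_tilde\<close>, so the
  gap is at most the difference of the two objectives there. The positive value forces the bracket
  to be positive, and this limits \<rho>.\<close>

lemma E_Fc_minus_E_Fc_tilde_le: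
  fixes W :: "'x::finite \<Rightarrow> 'y::finite pmf"
  assumes R: "0 < R" "capacity W / 2 \<le> R" "R < capacity W" and pos: "E_Fc W R > 0"
  shows "E_Fc W R - E_Fc_tilde W R \<le> 32 * (capacity W - R) ^ 4 / capacity W ^ 4"
proof -
  define C where "C = capacity W"
  define d where "d = C - R"
  have C: "C > 0"
    using R by (simp add: C_def)
  have "R / capacity W > 0"
    using R by simp
  then have cont: "continuous_on ({R / capacity W..1} \<times> {0..1} \<times> UNIV)
      (\<lambda>(r, \<rho>, e). (1 - r) * (- \<rho> * (R / r) + e * (1 - (1 + r) / 2 * e)))"
    by (auto simp: case_prod_unfold intro!: continuous_intros)
  obtain p r \<rho>
    where in_set: "(p, r, \<rho>) \<in> param_set W R"
      and val: "E_Fc W R = (1 - r) * (- \<rho> * (R / r) + E0 W \<rho> p * (1 - (1 + r) / 2 * E0 W \<rho> p))"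
    unfolding E_Fc_def
    by (rule max_on_param_set[OF R(3) C[unfolded C_def] cont]) blast
  define e where "e = E0 W \<rho> p"
  have r: "R / C \<le> r" "r \<le> 1" "0 < r" and \<rho>: "0 \<le> \<rho>"
    using in_set \<open>R / capacity W > 0\<close> by (auto simp: param_set_def C_def)
  have e: "0 \<le> e" "e \<le> \<rho> * C"
    using E0_nonneg[OF \<rho>, of W p] E0_le_capacity[OF \<rho>, of W p] by (auto simp: e_def C_def)
  have "- \<rho> * (R / r) + e * (1 - (1 + r) / 2 * e) > 0"
    using pos r by (simp add: val zero_less_mult_iff flip: e_def)
  then have bracket: "\<rho> * (R / r) + (1 + r) / 2 * e\<^sup>2 < e"
    by (simp add: algebra_simps power2_eq_square)
  have "\<rho> * R \<le> \<rho> * (R / r)"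
    using r \<rho> R by (intro mult_left_mono) (simp_all add: field_simps)
  moreover have "e\<^sup>2 / 2 \<le> (1 + r) / 2 * e\<^sup>2"
    using r mult_right_mono[of "1 / 2" "(1 + r) / 2" "e\<^sup>2"] by simp
  ultimately have *: "\<rho> * R + e\<^sup>2 / 2 < e"
    using bracket by linarith
  moreover have "e\<^sup>2 \<ge> 0" by simp
  ultimately have "\<rho> * R \<le> e"
    by linarith
  then have "(\<rho> * R)\<^sup>2 \<le> e\<^sup>2"
    using \<rho> R by (intro power_mono) auto
  \<comment> \<open>Combines the bracket with e \<le> \<rho> * C. Together with the lower bound
    \<rho> * R on \<open>e\<close>, a factor \<rho> cancels and \<rho> is at most of order
    \<open>d\<close>.\<close>
  moreover have "e\<^sup>2 / 2 < \<rho> * d"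
    using * e by (simp add: d_def algebra_simps)
  ultimately have sq: "(\<rho> * R)\<^sup>2 < 2 * (\<rho> * d)"
    by linarith
  then have "\<rho> \<noteq> 0"
    by auto
  with \<rho> have "\<rho> > 0"
    by simp
  with sq have "\<rho> * R\<^sup>2 < 2 * d"
    by (simp add: power2_eq_square mult.assoc mult.left_commute)
  \<comment> \<open>The assumption that R is at least half the capacity removes R from the bound on
    \<rho>.\<close>
  moreover have "\<rho> * (C / 2)\<^sup>2 \<le> \<rho> * R\<^sup>2"
    using \<rho> R by (intro mult_left_mono power_mono) (auto simp: C_def)
  ultimately have "\<rho> * C \<le> 8 * d / C"
    using C by (simp add: field_simps power2_eq_square)
  with e have "e\<^sup>2 \<le> (8 * d / C)\<^sup>2"
    by (intro power_mono) auto
  moreover have "1 - r \<le> d / C"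
    using r C by (simp add: d_def field_simps)
  then have "(1 - r)\<^sup>2 \<le> (d / C)\<^sup>2"
    using r by (intro power_mono) auto
  ultimately have "(1 - r)\<^sup>2 * e\<^sup>2 \<le> (d / C)\<^sup>2 * (8 * d / C)\<^sup>2"
    by (intro mult_mono) auto
  also have "\<dots> = 64 * d ^ 4 / C ^ 4"
    by (simp add: field_simps eval_nat_numeral)
  finally have "(1 - r)\<^sup>2 * e\<^sup>2 / 2 \<le> 32 * d ^ 4 / C ^ 4"
    by simp
  moreover have "E_Fc W R - (1 - r) * (- \<rho> * (R / r) + e * (1 - e)) = (1 - r)\<^sup>2 * e\<^sup>2 / 2"
    unfolding val e_def[symmetric] by (simp add: algebra_simps power2_eq_square add_divide_distrib diff_divide_distrib)
  ultimately show ?thesis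
    using E_Fc_tilde_ge_objective[OF R(1,3) in_set]
    unfolding C_def[symmetric] d_def[symmetric] e_def[symmetric] by linarith
qed

text \<open>The cubic lower bound makes the denominator positive near capacity and turns the quartic
  gap into a relative error linear in C - R; the ratio is then squeezed.\<close>

lemma E_Fc_ratio_tendsto_1:
  fixes W :: "'x::finite \<Rightarrow> 'y::finite pmf"
  assumes C: "capacity W > 0"
  shows "((\<lambda>R. E_Fc_tilde W R / E_Fc W R) \<longlongrightarrow> 1) (at_left (capacity W))"
proof -
  define C where "C = capacity W"
  have C: "C > 0"
    using assms by (simp add: C_def)
  obtain M where M: "M > 0" "\<And>R. 0 < R \<Longrightarrow> R < C \<Longrightarrow> C - R \<le> 4 * M \<Longrightarrow>
      (C - R) ^ 3 / (32 * C * M) \<le> E_Fc_tilde W R"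
    using E_Fc_tilde_cubic_lower_bound[OF assms] unfolding C_def by blast
  \<comment> \<open>The quartic gap 32 * d^4 / C^4 divided by d times the cubic bound d^3 / (32 * C
    * M).\<close>
  define L where "L = 1024 * M / C ^ 3"
  have bounds: "1 - L * (C - R) \<le> E_Fc_tilde W R / E_Fc W R \<and> E_Fc_tilde W R / E_Fc W R \<le> 1"
    if R: "0 < R" "C / 2 \<le> R" "R < C" "C - R \<le> 4 * M" for R
  proof -
    define d where "d = C - R"
    define b where "b = d ^ 3 / (32 * C * M)"
    have "d > 0"
      using R by (simp add: d_def)
    then have "b > 0"
      using C M by (simp add: b_def)
    have "b \<le> E_Fc_tilde W R"
      using M(2)[of R] R by (simp add: b_def d_def)
    moreover have le: "E_Fc_tilde W R \<le> E_Fc W R"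
      using R by (intro E_Fc_tilde_le_E_Fc) (auto simp: C_def)
    ultimately have ge: "b \<le> E_Fc W R"
      by linarith
    with \<open>b > 0\<close> have pos: "E_Fc W R > 0"
      by linarith
    have "E_Fc W R - E_Fc_tilde W R \<le> 32 * d ^ 4 / C ^ 4"
      using E_Fc_minus_E_Fc_tilde_le[of R W] R pos by (simp add: C_def d_def)
    also have "\<dots> = L * d * b"
      using C M by (simp add: L_def b_def field_simps eval_nat_numeral)
    also have "\<dots> \<le> L * d * E_Fc W R"
      using ge C M \<open>d > 0\<close> by (intro mult_left_mono) (auto simp: L_def)
    finally have "(1 - L * d) * E_Fc W R \<le> E_Fc_tilde W R"
      by (simp add: algebra_simps)
    with pos le show ?thesis
      by (simp add: pos_le_divide_eq pos_divide_le_eq flip: d_def)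
  qed
  \<comment> \<open>To the right of this point both smallness conditions of \<open>bounds\<close>
    hold, and R is positive.\<close>
  have "max (C / 2) (C - 4 * M) < C"
    using C M by simp
  then have ev: "\<forall>\<^sub>F R in at_left C. max (C / 2) (C - 4 * M) < R \<and> R < C"
    unfolding eventually_at_left_field by blast
  have "((\<lambda>R. 1 - L * (C - R)) \<longlongrightarrow> 1 - L * (C - C)) (at_left C)"
    by (intro tendsto_intros)
  then have lim: "((\<lambda>R. 1 - L * (C - R)) \<longlongrightarrow> 1) (at_left C)"
    by simp
  have "\<forall>\<^sub>F R in at_left C. 1 - L * (C - R) \<le> E_Fc_tilde W R / E_Fc W R"
    and "\<forall>\<^sub>F R in at_left C. E_Fc_tilde W R / E_Fc W R \<le> 1"
    using C by (auto intro!: eventually_mono[OF ev] conjunct1[OF bounds] conjunct2[OF bounds])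
  then show ?thesis
    unfolding C_def[symmetric] by (rule tendsto_sandwich[OF _ _ lim tendsto_const])
qed

theorem corollary1:
  fixes W :: "'x::finite \<Rightarrow> 'y::finite pmf"
  assumes "capacity W > 0"
  shows "(\<forall>R. 0 < R \<and> R < capacity W \<longrightarrow>
            E_Fc_tilde W R \<le> E_Fc W R \<and> E_Fc W R \<le> E_c W R) \<and>
         ((\<lambda>R. E_Fc_tilde W R / E_Fc W R) \<longlongrightarrow> 1) (at_left (capacity W))"
  using E_Fc_tilde_le_E_Fc E_Fc_le_E_c E_Fc_ratio_tendsto_1[OF assms] by blast

end
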